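(* Let $K$ be an algebraically closed field of characteristic zero, let $\Phi=(f_1,\dots,f_n)$ be a polynomial automorphism of $K^n$, let $\deg_1$ be the standard homogeneous degree on $K[x_1,\dots,x_n]$, let $d_i=\deg_1(f_i)$, and let $\deg_2$ be the weighted degree on $K[x_1,\dots,x_n]$ assigning weight $d_i$ to $x_i$. Let $I=\{P : P(\overline{f_1},\dots,\overline{f_n})=0\}$ be the ideal of relations, where $\overline{f_i}$ is the homogeneous component of $f_i$ of highest degree. If $I$ is principal, $I=(R)$, then $\deg_2(R)\le d_1+\dots+d_n-n+1$.
   Context: $\deg_2(0)=-\infty$. *)

theory Defs
  imports "HOL-Library.Poly_Mapping" "HOL-Library.Extended_Real"
          "HOL-Computational_Algebra.Polynomial"
begin

text \<open>Multivariate polynomials over 'a in the variables x_0, x_1, ... are represented as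
  finitely supported maps from monomials (exponent vectors nat =>0 nat) to coefficients.
  Multiplication is the convolution product from Poly_Mapping.\<close>

type_synonym 'a mpoly = "(nat \<Rightarrow>\<^sub>0 nat) \<Rightarrow>\<^sub>0 'a"

definition in_ring :: "nat \<Rightarrow> 'a::zero mpoly \<Rightarrow> bool" where
  "in_ring n p \<longleftrightarrow> (\<forall>m \<in> Poly_Mapping.keys p. Poly_Mapping.keys m \<subseteq> {..<n})"

definition Var :: "nat \<Rightarrow> 'a::{zero,one} mpoly" where
  "Var i = Poly_Mapping.single (Poly_Mapping.single i 1) 1"

definition subst :: "'a::comm_ring_1 mpoly \<Rightarrow> (nat \<Rightarrow> 'a mpoly) \<Rightarrow> 'a mpoly" where
  "subst p g = (\<Sum>m\<in>Poly_Mapping.keys p. Poly_Mapping.single 0 (Poly_Mapping.lookup p m) *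
                   (\<Prod>i\<in>Poly_Mapping.keys m. g i ^ Poly_Mapping.lookup m i))"

definition mon_wdeg :: "(nat \<Rightarrow> nat) \<Rightarrow> (nat \<Rightarrow>\<^sub>0 nat) \<Rightarrow> nat" where
  "mon_wdeg w m = (\<Sum>i\<in>Poly_Mapping.keys m. w i * Poly_Mapping.lookup m i)"

definition wdeg :: "(nat \<Rightarrow> nat) \<Rightarrow> 'a::zero mpoly \<Rightarrow> ereal" where
  "wdeg w p = (if p = 0 then -\<infinity> else ereal (real (Max (mon_wdeg w ` Poly_Mapping.keys p))))"

abbreviation deg1 :: "'a::zero mpoly \<Rightarrow> ereal" where
  "deg1 p \<equiv> wdeg (\<lambda>_. 1) p"

text \<open>Total degree as a natural number (used for d_i = deg_1 f_i, f_i nonzero).\<close>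
definition tdeg :: "'a::zero mpoly \<Rightarrow> nat" where
  "tdeg p = Max (mon_wdeg (\<lambda>_. 1) ` Poly_Mapping.keys p)"

definition top_form :: "'a::comm_monoid_add mpoly \<Rightarrow> 'a mpoly" where
  "top_form p = (\<Sum>m\<in>{m\<in>Poly_Mapping.keys p. mon_wdeg (\<lambda>_. 1) m = tdeg p}.
                    Poly_Mapping.single m (Poly_Mapping.lookup p m))"

definition poly_automorphism :: "nat \<Rightarrow> (nat \<Rightarrow> 'a::comm_ring_1 mpoly) \<Rightarrow> bool" where
  "poly_automorphism n f \<longleftrightarrow> (\<forall>i<n. in_ring n (f i)) \<and>
     (\<exists>g. (\<forall>i<n. in_ring n (g i)) \<and>
          (\<forall>i<n. subst (f i) g = Var i) \<and> (\<forall>i<n. subst (g i) f = Var i))"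

definition alg_closed :: "'a::field itself \<Rightarrow> bool" where
  "alg_closed _ \<longleftrightarrow> (\<forall>p::'a poly. degree p \<noteq> 0 \<longrightarrow> (\<exists>x. poly p x = 0))"

end

theory Submission
  imports Defs "Jordan_Normal_Form.Determinant"
begin

text \<open>The argument is Venereau's "parachute". Put \<open>\<nabla> = d\<^sub>1 + \<dots> + d\<^sub>n - n\<close> and let \<open>F\<close> be the
  tuple of leading forms of \<open>f\<close>. The chain rule and Cramer's rule express
  \<open>(\<partial>\<^sub>i P)(f) \<cdot> det J(f)\<close> as the determinant of the Jacobian matrix whose \<open>i\<close>-th gradient is replaced
  by that of \<open>P(f)\<close>; as the Jacobian does not vanish, this gives
  \<open>deg (\<partial>\<^sub>i P)(f) + d\<^sub>i \<le> deg P(f) + \<nabla>\<close>. If the \<open>deg\<^sub>2\<close>-leading form of \<open>P\<close> is \<open>Q R\<^sup>k\<close> with \<open>Q\<close> not in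
  \<open>(R)\<close>, choose \<open>i\<close> with \<open>\<partial>\<^sub>i R\<close> not in \<open>(R)\<close>. As \<open>(R)\<close> is prime and the characteristic is zero, the
  leading form of the \<open>k\<close>-fold derivative of \<open>P\<close> is not in \<open>(R)\<close>, so that
  \<open>deg P(f) \<ge> deg\<^sub>2 P - k \<nabla> \<ge> k (deg\<^sub>2 R - \<nabla>)\<close>. Now take for \<open>P\<close> the components of the inverse
  of \<open>f\<close>, for which \<open>P(f)\<close> is a variable, of degree 1. If \<open>deg\<^sub>2 R \<ge> \<nabla> + 2\<close>, then \<open>k = 0\<close>, hence the
  leading forms of the inverse map \<open>F\<close> to the variables, and \<open>F\<close> has nonvanishing Jacobian. Then
  differentiating \<open>R(F) = 0\<close> puts every \<open>\<partial>\<^sub>i R\<close> into \<open>(R)\<close>, a contradiction.\<close>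

section \<open>Sums over monomials\<close>

lemma poly_mapping_eq_sum_single:
  "p = (\<Sum>m\<in>Poly_Mapping.keys p. Poly_Mapping.single m (Poly_Mapping.lookup p m))"
  by (rule poly_mapping_eqI)
     (auto simp: lookup_sum lookup_single when_def in_keys_iff sum.delta)

lemma poly_mapping_single_induct [case_names single add]:
  fixes p :: "'a \<Rightarrow>\<^sub>0 'b::comm_monoid_add"
  assumes single: "\<And>m c. P (Poly_Mapping.single m c)"
    and add: "\<And>p q. P p \<Longrightarrow> P q \<Longrightarrow> P (p + q)"
  shows "P p"
proof -
  have "P (\<Sum>m\<in>A. Poly_Mapping.single m (c m))" for A and c
    \<comment> \<open>The zero term supplies \<open>P 0\<close> for the empty sum.\<close>
    using single[of _ 0] by (induction A rule: infinite_finite_induct) (auto intro: assms)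
  then show ?thesis
    by (subst poly_mapping_eq_sum_single)
qed

definition mon_eval :: "(nat \<Rightarrow> 'b::comm_monoid_mult) \<Rightarrow> (nat \<Rightarrow>\<^sub>0 nat) \<Rightarrow> 'b" where
  "mon_eval g m = (\<Prod>i\<in>Poly_Mapping.keys m. g i ^ Poly_Mapping.lookup m i)"

lemma mon_eval_superset:
  assumes "finite A" "Poly_Mapping.keys m \<subseteq> A"
  shows "mon_eval g m = (\<Prod>i\<in>A. g i ^ Poly_Mapping.lookup m i)"
  unfolding mon_eval_def by (rule prod.mono_neutral_left) (use assms in \<open>auto simp: in_keys_iff\<close>)

lemma mon_eval_zero [simp]: "mon_eval g 0 = 1"
  by (simp add: mon_eval_def)

lemma mon_eval_add: "mon_eval g (m + m') = mon_eval g m * mon_eval g m'"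
proof -
  let ?A = "Poly_Mapping.keys m \<union> Poly_Mapping.keys m'"
  have "Poly_Mapping.keys (m + m') \<subseteq> ?A"
    by (rule Poly_Mapping.keys_add)
  then show ?thesis
    by (simp add: mon_eval_superset[of ?A] lookup_add power_add prod.distrib)
qed

lemma mon_wdeg_superset:
  assumes "finite A" "Poly_Mapping.keys m \<subseteq> A"
  shows "mon_wdeg w m = (\<Sum>i\<in>A. w i * Poly_Mapping.lookup m i)"
  unfolding mon_wdeg_def by (rule sum.mono_neutral_left) (use assms in \<open>auto simp: in_keys_iff\<close>)

lemma mon_wdeg_zero [simp]: "mon_wdeg w 0 = 0"
  by (simp add: mon_wdeg_def)

lemma mon_wdeg_single [simp]: "mon_wdeg w (Poly_Mapping.single i k) = w i * k"
  by (simp add: mon_wdeg_def)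

lemma mon_wdeg_add: "mon_wdeg w (m + m') = mon_wdeg w m + mon_wdeg w m'"
proof -
  let ?A = "Poly_Mapping.keys m \<union> Poly_Mapping.keys m'"
  have "Poly_Mapping.keys (m + m') \<subseteq> ?A"
    by (rule Poly_Mapping.keys_add)
  then show ?thesis
    by (simp add: mon_wdeg_superset[of ?A] lookup_add algebra_simps sum.distrib)
qed

section \<open>Substitution\<close>

lemma subst_mon_eval:
  "subst p g = (\<Sum>m\<in>Poly_Mapping.keys p. Poly_Mapping.single 0 (Poly_Mapping.lookup p m) * mon_eval g m)"
  by (simp add: subst_def mon_eval_def)

lemma subst_single: "subst (Poly_Mapping.single m c) g = Poly_Mapping.single 0 c * mon_eval g m"
  by (simp add: subst_mon_eval)

lemma subst_const [simp]: "subst (Poly_Mapping.single 0 c) g = Poly_Mapping.single 0 c"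
  by (simp add: subst_single)

lemma subst_zero [simp]: "subst 0 g = 0"
  by (simp add: subst_mon_eval)

lemma subst_one [simp]: "subst 1 g = 1"
  using subst_const[of 1] by simp

lemma subst_Var [simp]: "subst (Var i) g = g i"
  by (simp add: Var_def subst_single mon_eval_def)

lemma subst_add [simp]: "subst (p + q) g = subst p g + subst q g"
  unfolding subst_mon_eval
  by (rule setsum_keys_plus_distrib) (simp_all add: single_add distrib_right)

lemma subst_sum: "subst (\<Sum>x\<in>A. h x) g = (\<Sum>x\<in>A. subst (h x) g)"
  by (induction A rule: infinite_finite_induct) auto

lemma subst_mult [simp]: "subst (p * q) g = subst p g * subst q g"
proof (induction p rule: poly_mapping_single_induct)
  case (single m c)
  show ?case
  proof (induction q rule: poly_mapping_single_induct)
    case (single m' c')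
    have c: "Poly_Mapping.single 0 (c * c') = Poly_Mapping.single 0 c * (Poly_Mapping.single 0 c' :: 'a mpoly)"
      by (simp add: mult_single)
    show ?case
      unfolding mult_single subst_single mon_eval_add
      unfolding c by (simp only: ac_simps)
  qed (simp add: distrib_left)
qed (simp add: distrib_right)

lemma subst_of_nat [simp]: "subst (of_nat k) g = of_nat k"
  by (induction k) auto

section \<open>The ring of polynomials in the first n variables\<close>

lemma in_ring_zero [simp]: "in_ring n 0"
  by (simp add: in_ring_def)

lemma in_ring_single: "Poly_Mapping.keys m \<subseteq> {..<n} \<Longrightarrow> in_ring n (Poly_Mapping.single m c)"
  by (simp add: in_ring_def)

lemma in_ring_one [simp]: "in_ring n (1 :: 'a::comm_ring_1 mpoly)"
  by (simp add: in_ring_def)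

lemma in_ring_add: "in_ring n p \<Longrightarrow> in_ring n q \<Longrightarrow> in_ring n (p + q)"
  unfolding in_ring_def using Poly_Mapping.keys_add[of p q] by blast

lemma in_ring_sum: "(\<And>x. x \<in> A \<Longrightarrow> in_ring n (h x)) \<Longrightarrow> in_ring n (\<Sum>x\<in>A. h x)"
  by (induction A rule: infinite_finite_induct) (auto intro: in_ring_add)

lemma in_ring_mult:
  assumes "in_ring n p" "in_ring n q"
  shows "in_ring n (p * q)"
  unfolding in_ring_def
proof
  fix m assume "m \<in> Poly_Mapping.keys (p * q)"
  then obtain a b where "a \<in> Poly_Mapping.keys p" "b \<in> Poly_Mapping.keys q" "m = a + b"
    using keys_mult[of p q] by auto
  then show "Poly_Mapping.keys m \<subseteq> {..<n}"
    using assms Poly_Mapping.keys_add[of a b] unfolding in_ring_def by blast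
qed

lemma in_ring_of_nat: "in_ring n (of_nat k :: 'a::comm_ring_1 mpoly)"
  by (induction k) (auto intro: in_ring_add)

lemma mon_eval_Var:
  "mon_eval Var m = (Poly_Mapping.single m 1 :: 'a::comm_ring_1 mpoly)"
proof -
  have pow: "Var i ^ k = (Poly_Mapping.single (Poly_Mapping.single i k) 1 :: 'a mpoly)" for i k
    by (induction k) (auto simp: Var_def mult_single single_add[symmetric])
  have "(\<Prod>i\<in>A. Poly_Mapping.single (a i) 1) = (Poly_Mapping.single (\<Sum>i\<in>A. a i) 1 :: 'a mpoly)"
    for A :: "nat set" and a
    by (induction A rule: infinite_finite_induct) (auto simp: mult_single)
  then show ?thesis
    unfolding mon_eval_def pow by (simp flip: poly_mapping_eq_sum_single)
qed

text \<open>Constants and the first \<open>n\<close> variables generate the ring, so a property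
  stable under sums and products, such as \<open>chain_rule\<close>, need only be checked on
  them.\<close>

lemma in_ring_induct [consumes 1, case_names const Var add mult]:
  fixes p :: "'a::comm_ring_1 mpoly"
  assumes p: "in_ring n p"
    and const: "\<And>c. P (Poly_Mapping.single 0 c)"
    and Var: "\<And>i. i < n \<Longrightarrow> P (Var i)"
    and add: "\<And>p q. P p \<Longrightarrow> P q \<Longrightarrow> P (p + q)"
    and mult: "\<And>p q. P p \<Longrightarrow> P q \<Longrightarrow> P (p * q)"
  shows "P p"
proof -
  have zero: "P 0" and one: "P 1"
    using const[of 0] const[of 1] by simp_all
  have pow: "P (q ^ k)" if "P q" for q k
    using that by (induction k) (auto intro: one mult)
  have "P (Poly_Mapping.single m c)" if "Poly_Mapping.keys m \<subseteq> {..<n}" for m c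
  proof -
    have "P (\<Prod>i\<in>A. Var i ^ k i)" if "A \<subseteq> {..<n}" for A and k :: "nat \<Rightarrow> nat"
      using that by (induction A rule: infinite_finite_induct) (auto intro: one mult pow Var)
    from this[OF that] have "P (mon_eval Var m)"
      by (simp add: mon_eval_def)
    from mult[OF const[of c] this] show ?thesis
      by (simp add: mon_eval_Var mult_single)
  qed
  then have "P (\<Sum>m\<in>A. Poly_Mapping.single m (Poly_Mapping.lookup p m))"
    if "A \<subseteq> Poly_Mapping.keys p" for A
    using that p by (induction A rule: infinite_finite_induct) (auto intro: zero add simp: in_ring_def)
  then show ?thesis
    by (subst poly_mapping_eq_sum_single) auto
qed

section \<open>Weighted gradings\<close>

text \<open>The substitution \<open>x\<^sub>i \<mapsto> x\<^sub>i t\<^bsup>w i\<^esup>\<close>: the coefficient of \<open>t\<^bsup>e\<^esup>\<close> is the weighted homogeneous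
  component of degree \<open>e\<close>, so degrees and leading forms become those of univariate polynomials.\<close>

definition grade :: "(nat \<Rightarrow> nat) \<Rightarrow> 'a::comm_ring_1 mpoly \<Rightarrow> 'a mpoly poly" where
  "grade w p = (\<Sum>m\<in>Poly_Mapping.keys p.
     monom (Poly_Mapping.single m (Poly_Mapping.lookup p m)) (mon_wdeg w m))"

abbreviation gdeg :: "(nat \<Rightarrow> nat) \<Rightarrow> 'a::comm_ring_1 mpoly \<Rightarrow> nat" where
  "gdeg w p \<equiv> degree (grade w p)"

lemma grade_single: "grade w (Poly_Mapping.single m c) = monom (Poly_Mapping.single m c) (mon_wdeg w m)"
  by (simp add: grade_def)

lemma grade_zero [simp]: "grade w 0 = 0"
  by (simp add: grade_def)

lemma grade_const [simp]: "grade w (Poly_Mapping.single 0 c) = [:Poly_Mapping.single 0 c:]"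
  by (simp add: grade_single monom_0)

lemma grade_one [simp]: "grade w 1 = 1"
  using grade_const[of w 1] by (simp add: one_pCons)

lemma grade_Var: "grade w (Var i) = monom (Var i) (w i)"
  by (simp add: Var_def grade_single)

lemma grade_add [simp]: "grade w (p + q) = grade w p + grade w q"
  unfolding grade_def
  by (rule setsum_keys_plus_distrib) (simp_all add: single_add add_monom)

lemma grade_uminus [simp]: "grade w (- p) = - grade w p"
  by (metis add.right_inverse add_eq_0_iff grade_add grade_zero)

lemma grade_mult [simp]: "grade w (p * q) = grade w p * grade w q"
proof (induction p rule: poly_mapping_single_induct)
  case (single m c)
  show ?case
    by (induction q rule: poly_mapping_single_induct)
       (simp_all add: mult_single grade_single mon_wdeg_add mult_monom distrib_left)
qed (simp add: distrib_right)

lemma grade_sum: "grade w (\<Sum>x\<in>A. h x) = (\<Sum>x\<in>A. grade w (h x))"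
  by (induction A rule: infinite_finite_induct) auto

lemma grade_prod: "grade w (\<Prod>x\<in>A. h x) = (\<Prod>x\<in>A. grade w (h x))"
  by (induction A rule: infinite_finite_induct) auto

lemma grade_power: "grade w (p ^ k) = grade w p ^ k"
  by (induction k) auto

lemma coeff_grade:
  "coeff (grade w p) e = (\<Sum>m\<in>Poly_Mapping.keys p.
     if mon_wdeg w m = e then Poly_Mapping.single m (Poly_Mapping.lookup p m) else 0)"
  by (simp add: grade_def coeff_sum)

lemma lookup_coeff_grade:
  "Poly_Mapping.lookup (coeff (grade w p) e) m = (if mon_wdeg w m = e then Poly_Mapping.lookup p m else 0)"
proof (induction p rule: poly_mapping_single_induct)
  case (single m' c)
  show ?case by (auto simp: grade_single lookup_single when_def)
qed (auto simp: lookup_add)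

text \<open>Each coefficient of \<open>p\<close> reappears in the component of its monomial's
  weight.\<close>

lemma grade_eq_0_iff [simp]: "grade w p = 0 \<longleftrightarrow> p = 0"
proof
  assume "grade w p = 0"
  then show "p = 0"
    using lookup_coeff_grade[of w p] by (intro poly_mapping_eqI) (metis coeff_0 lookup_zero)
qed simp

lemma gdeg_eq_Max:
  assumes "p \<noteq> 0"
  shows "gdeg w p = Max (mon_wdeg w ` Poly_Mapping.keys p)"
proof (rule Max_eqI[symmetric])
  fix e assume "e \<in> mon_wdeg w ` Poly_Mapping.keys p"
  then obtain m where m: "m \<in> Poly_Mapping.keys p" "e = mon_wdeg w m"
    by auto
  then have "coeff (grade w p) e \<noteq> 0"
    by (metis in_keys_iff lookup_coeff_grade lookup_zero)
  then show "e \<le> gdeg w p"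
    by (rule le_degree)
next
  have "coeff (grade w p) (gdeg w p) \<noteq> 0"
    using assms by simp
  then obtain m where "Poly_Mapping.lookup (coeff (grade w p) (gdeg w p)) m \<noteq> 0"
    by (metis lookup_zero poly_mapping_eqI)
  then have "mon_wdeg w m = gdeg w p" "m \<in> Poly_Mapping.keys p"
    by (auto simp: lookup_coeff_grade in_keys_iff split: if_splits)
  then show "gdeg w p \<in> mon_wdeg w ` Poly_Mapping.keys p"
    by (intro image_eqI[of _ _ m]) auto
qed auto

lemma wdeg_eq_gdeg: "p \<noteq> 0 \<Longrightarrow> wdeg w p = ereal (real (gdeg w p))"
  by (simp add: wdeg_def gdeg_eq_Max)

lemma tdeg_eq_gdeg: "p \<noteq> 0 \<Longrightarrow> tdeg p = gdeg (\<lambda>_. 1) p"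
  by (simp add: tdeg_def gdeg_eq_Max)

lemma top_form_eq_lead_coeff: "p \<noteq> 0 \<Longrightarrow> top_form p = lead_coeff (grade (\<lambda>_. 1) p)"
  by (simp add: top_form_def coeff_grade tdeg_eq_gdeg sum.inter_filter)

lemma in_ring_coeff_grade: "in_ring n p \<Longrightarrow> in_ring n (coeff (grade w p) e)"
  unfolding coeff_grade by (intro in_ring_sum) (auto simp: in_ring_def)

lemma grade_coeff_grade: "grade w (coeff (grade w p) e) = monom (coeff (grade w p) e) e"
proof (induction p rule: poly_mapping_single_induct)
  case (single m c)
  show ?case by (simp add: grade_single)
qed (simp add: add_monom[symmetric])

lemma gdeg_mult:
  fixes p q :: "'a::idom mpoly"
  shows "p \<noteq> 0 \<Longrightarrow> q \<noteq> 0 \<Longrightarrow> gdeg w (p * q) = gdeg w p + gdeg w q"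
  by (simp add: degree_mult_eq)

text \<open>The bounds below carry the alternative \<open>p = 0\<close> because the zero polynomial has
  \<open>gdeg\<close> equal to 0 rather than minus infinity.\<close>

lemma gdeg_sum_bound:
  assumes "\<And>x. x \<in> A \<Longrightarrow> h x = 0 \<or> gdeg w (h x) + s \<le> t"
  shows "(\<Sum>x\<in>A. h x) = 0 \<or> gdeg w (\<Sum>x\<in>A. h x) + s \<le> t"
  using assms
proof (induction A rule: infinite_finite_induct)
  case (insert x A)
  have "gdeg w (h x + (\<Sum>x\<in>A. h x)) \<le> max (gdeg w (h x)) (gdeg w (\<Sum>x\<in>A. h x))"
    by (simp add: degree_add_le_max)
  then show ?case
    using insert by (cases "h x = 0"; cases "(\<Sum>x\<in>A. h x) = 0") fastforce+
qed auto

lemma gdeg_prod_bound: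
  fixes h :: "'b \<Rightarrow> 'a::idom mpoly"
  assumes "\<And>x. x \<in> A \<Longrightarrow> h x = 0 \<or> gdeg w (h x) + s x \<le> t x" "finite A"
  shows "(\<Prod>x\<in>A. h x) = 0 \<or> gdeg w (\<Prod>x\<in>A. h x) + (\<Sum>x\<in>A. s x) \<le> (\<Sum>x\<in>A. t x)"
  using assms(2,1)
proof (induction A rule: finite_induct)
  case (insert x A)
  then show ?case
    by (cases "h x = 0"; cases "(\<Prod>x\<in>A. h x) = 0") (fastforce simp: degree_mult_eq)+
qed auto

text \<open>Over a domain, inserting \<open>f\<close> into a monomial of weight \<open>d\<close>
  gives degree exactly \<open>d\<close>, with leading form the monomial in the leading forms.
  Cancellation in degree \<open>e\<close> is thus a relation among leading forms.\<close>

lemma coeff_grade_subst: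
  fixes p :: "'a::idom mpoly"
  assumes p: "in_ring n p" and f: "\<And>i. i < n \<Longrightarrow> f i \<noteq> 0"
    and e: "gdeg (\<lambda>i. tdeg (f i)) p \<le> e"
  shows "coeff (grade (\<lambda>_. 1) (subst p f)) e
       = subst (coeff (grade (\<lambda>i. tdeg (f i)) p) e) (\<lambda>i. top_form (f i))"
proof -
  let ?w = "\<lambda>i. tdeg (f i)" and ?F = "\<lambda>i. top_form (f i)"
  have termwise: "coeff (grade (\<lambda>_. 1) (Poly_Mapping.single 0 c * mon_eval f m)) e
     = subst (if mon_wdeg ?w m = e then Poly_Mapping.single m c else 0) ?F"
    if m: "m \<in> Poly_Mapping.keys p" for m c
  proof -
    have sub: "Poly_Mapping.keys m \<subseteq> {..<n}"
      using p m by (auto simp: in_ring_def)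
    let ?G = "grade (\<lambda>_. 1) (mon_eval f m)"
    have G: "?G = (\<Prod>i\<in>Poly_Mapping.keys m. grade (\<lambda>_. 1) (f i) ^ Poly_Mapping.lookup m i)"
      by (simp add: mon_eval_def grade_prod grade_power)
    have "degree ?G = (\<Sum>i\<in>Poly_Mapping.keys m. Poly_Mapping.lookup m i * gdeg (\<lambda>_. 1) (f i))"
      unfolding G using sub f
      by (subst degree_prod_eq_sum_degree) (auto intro!: sum.cong simp: degree_power_eq subset_iff)
    also have "\<dots> = mon_wdeg ?w m"
      unfolding mon_wdeg_def using sub f
      by (intro sum.cong) (auto simp: tdeg_eq_gdeg subset_iff)
    finally have deg: "degree ?G = mon_wdeg ?w m" .
    have "lead_coeff ?G = mon_eval ?F m"
      unfolding G unfolding mon_eval_def lead_coeff_prod lead_coeff_power using sub f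
      by (intro prod.cong) (auto simp: top_form_eq_lead_coeff subset_iff)
    then have lead: "coeff ?G (mon_wdeg ?w m) = mon_eval ?F m"
      by (simp only: deg)
    have "coeff (grade ?w p) (mon_wdeg ?w m) \<noteq> 0"
      using m by (metis in_keys_iff lookup_coeff_grade lookup_zero)
    then have "mon_wdeg ?w m \<le> e"
      using e le_degree order_trans by blast
    \<comment> \<open>A monomial of weight below \<open>e\<close> yields 0 on both sides, since
      \<open>e\<close> exceeds the degree.\<close>
    then show ?thesis
      using deg lead by (auto simp: subst_single coeff_eq_0)
  qed
  show ?thesis
    unfolding subst_mon_eval[of p f] coeff_grade[of ?w p e] subst_sum grade_sum coeff_sum
    by (rule sum.cong[OF refl]) (rule termwise)
qed

section \<open>Partial derivatives\<close>

text \<open>Exponent subtraction truncates at 0, harmlessly: a term without the \<open>k\<close>-th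
  variable gets coefficient 0.\<close>

definition pd :: "nat \<Rightarrow> 'a::comm_ring_1 mpoly \<Rightarrow> 'a mpoly" where
  "pd k p = (\<Sum>m\<in>Poly_Mapping.keys p.
     Poly_Mapping.single (m - Poly_Mapping.single k 1) (of_nat (Poly_Mapping.lookup m k) * Poly_Mapping.lookup p m))"

lemma pd_single: "pd k (Poly_Mapping.single m c) =
    Poly_Mapping.single (m - Poly_Mapping.single k 1) (of_nat (Poly_Mapping.lookup m k) * c)"
  by (simp add: pd_def)

lemma pd_zero [simp]: "pd k 0 = 0"
  by (simp add: pd_def)

lemma pd_const [simp]: "pd k (Poly_Mapping.single 0 c) = 0"
  by (simp add: pd_single)

lemma pd_Var: "pd k (Var i) = (if i = k then 1 else 0)"
  by (simp add: Var_def pd_single lookup_single)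

lemma pd_add [simp]: "pd k (p + q) = pd k p + pd k q"
  unfolding pd_def
  by (rule setsum_keys_plus_distrib) (simp_all add: single_add distrib_left)

lemma add_minus_single:
  fixes m m' :: "nat \<Rightarrow>\<^sub>0 nat"
  assumes "Poly_Mapping.lookup m k \<noteq> 0"
  shows "m - Poly_Mapping.single k 1 + m' = m + m' - Poly_Mapping.single k 1"
  using assms by (intro poly_mapping_eqI) (auto simp: lookup_add lookup_minus lookup_single when_def)

lemma pd_mult: "pd k (p * q) = pd k p * q + p * pd k q"
proof (induction p rule: poly_mapping_single_induct)
  case (single m c)
  show ?case
  proof (induction q rule: poly_mapping_single_induct)
    case (single m' c')
    let ?e = "Poly_Mapping.single k (1::nat)"
    let ?a = "of_nat (Poly_Mapping.lookup m k) :: 'a" and ?b = "of_nat (Poly_Mapping.lookup m' k) :: 'a"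
    \<comment> \<open>Where truncation would spoil the exponents, both coefficients are 0.\<close>
    have 1: "Poly_Mapping.single (m - ?e + m') (?a * c * c') = Poly_Mapping.single (m + m' - ?e) (?a * c * c')"
      by (cases "Poly_Mapping.lookup m k = 0") (simp_all add: add_minus_single del: One_nat_def)
    have 2: "Poly_Mapping.single (m + (m' - ?e)) (c * (?b * c')) = Poly_Mapping.single (m + m' - ?e) (c * (?b * c'))"
      using add_minus_single[of m' k m]
      by (cases "Poly_Mapping.lookup m' k = 0") (simp_all add: add.commute del: One_nat_def)
    have "pd k (Poly_Mapping.single m c * Poly_Mapping.single m' c')
        = Poly_Mapping.single (m + m' - ?e) (?a * c * c' + c * (?b * c'))"
      by (simp add: mult_single pd_single lookup_add algebra_simps)
    then show ?case
      by (simp only: 1 2 mult_single pd_single single_add)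
  qed (simp add: algebra_simps)
qed (simp add: algebra_simps)

lemma pd_power_Suc: "pd k (p ^ Suc j) = of_nat (Suc j) * p ^ j * pd k p"
  by (induction j) (simp_all add: pd_mult algebra_simps)

lemma in_ring_pd: "in_ring n p \<Longrightarrow> in_ring n (pd k p)"
proof -
  assume p: "in_ring n p"
  have "Poly_Mapping.keys (m - Poly_Mapping.single k 1) \<subseteq> Poly_Mapping.keys m" for m :: "nat \<Rightarrow>\<^sub>0 nat"
    by (auto simp: in_keys_iff lookup_minus)
  then show ?thesis
    unfolding pd_def using p by (intro in_ring_sum in_ring_single) (auto simp: in_ring_def)
qed

text \<open>Differentiation lowers the weight of every surviving term by \<open>w k\<close>; the
  form \<open>e + w k\<close> avoids truncated subtraction.\<close>

lemma coeff_grade_pd: "coeff (grade w (pd k p)) e = pd k (coeff (grade w p) (e + w k))"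
proof (induction p rule: poly_mapping_single_induct)
  case (single m c)
  show ?case
  proof (cases "Poly_Mapping.lookup m k = 0")
    case False
    then have "m - Poly_Mapping.single k 1 + Poly_Mapping.single k 1 = m"
      by (simp add: add_minus_single del: One_nat_def)
    then have "mon_wdeg w m = mon_wdeg w (m - Poly_Mapping.single k 1) + w k"
      by (metis mon_wdeg_add mon_wdeg_single mult.right_neutral)
    then show ?thesis
      by (simp add: pd_single grade_single)
  qed (simp add: pd_single grade_single)
qed simp

lemma gdeg_pd: "pd k p = 0 \<or> gdeg w (pd k p) + w k \<le> gdeg w p"
proof (cases "pd k p = 0")
  case False
  then have "pd k (coeff (grade w p) (gdeg w (pd k p) + w k)) \<noteq> 0"
    by (simp flip: coeff_grade_pd)
  then have "coeff (grade w p) (gdeg w (pd k p) + w k) \<noteq> 0"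
    by (metis pd_zero)
  then show ?thesis
    by (simp add: le_degree)
qed simp

text \<open>In characteristic zero a positive exponent is a nonzero factor, so a monomial containing
  a variable survives in that derivative.\<close>

lemma const_if_pd_zero:
  fixes p :: "'a::{idom,ring_char_0} mpoly"
  assumes p: "in_ring n p" and pd: "\<And>k. k < n \<Longrightarrow> pd k p = 0"
  shows "p = Poly_Mapping.single 0 (Poly_Mapping.lookup p 0)"
proof -
  \<comment> \<open>Lowering the exponent of \<open>k\<close> is injective where it is positive, so
    no two terms merge.\<close>
  have lookup: "Poly_Mapping.lookup (pd k q) (m - Poly_Mapping.single k 1)
      = of_nat (Poly_Mapping.lookup m k) * Poly_Mapping.lookup q m"
    if k: "Poly_Mapping.lookup m k \<noteq> 0" for m k and q :: "'a mpoly"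
  proof (induction q rule: poly_mapping_single_induct)
    case (single m' c)
    have "m = m'" if "m' - Poly_Mapping.single k 1 = m - Poly_Mapping.single k 1" "Poly_Mapping.lookup m' k \<noteq> 0"
      using add_minus_single[OF k, of "Poly_Mapping.single k 1"]
        add_minus_single[OF that(2), of "Poly_Mapping.single k 1"] that(1) by simp
    then show ?case
      by (auto simp: pd_single lookup_single when_def)
  qed (simp add: lookup_add algebra_simps)
  have "m = 0" if m: "m \<in> Poly_Mapping.keys p" for m
  proof (rule ccontr)
    assume "m \<noteq> 0"
    then obtain k where k: "Poly_Mapping.lookup m k \<noteq> 0"
      by (metis lookup_zero poly_mapping_eqI)
    then have "k < n"
      using p m by (auto simp: in_ring_def in_keys_iff subset_iff)
    then show False
      using lookup[OF k, of p] pd[of k] k m by (auto simp: in_keys_iff)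
  qed
  then show ?thesis
    by (intro poly_mapping_eqI) (auto simp: lookup_single when_def in_keys_iff)
qed

lemma chain_rule:
  assumes "in_ring n p"
  shows "pd k (subst p f) = (\<Sum>j<n. pd k (f j) * subst (pd j p) f)"
  using assms
proof (induction p rule: in_ring_induct)
  case (Var i)
  have "(\<Sum>j<n. pd k (f j) * subst (pd j (Var i)) f) = (\<Sum>j<n. if j = i then pd k (f j) else 0)"
    by (intro sum.cong) (auto simp: pd_Var)
  then show ?case
    using Var by simp
next
  case (mult p q)
  then show ?case
    by (simp add: pd_mult sum_distrib_left sum_distrib_right sum.distrib algebra_simps)
qed (simp_all add: sum.distrib algebra_simps)

section \<open>Jacobians\<close>

text \<open>The columns are the gradients of the \<open>f j\<close>, so exchanging a gradient is
  \<open>replace_col\<close>.\<close>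

definition jac :: "nat \<Rightarrow> (nat \<Rightarrow> 'a::comm_ring_1 mpoly) \<Rightarrow> 'a mpoly mat" where
  "jac n f = mat n n (\<lambda>(k, j). pd k (f j))"

lemma jac_carrier [simp]: "jac n f \<in> carrier_mat n n"
  by (simp add: jac_def)

text \<open>By the chain rule the gradient of \<open>subst p f\<close> is the Jacobian matrix
  applied to the vector of all \<open>subst (pd j p) f\<close>; Cramer's rule isolates entry
  \<open>i\<close>.\<close>

lemma jac_cramer:
  fixes f :: "nat \<Rightarrow> 'a::idom mpoly"
  assumes p: "in_ring n p" and i: "i < n"
  shows "det (replace_col (jac n f) (vec n (\<lambda>k. pd k (subst p f))) i) = subst (pd i p) f * det (jac n f)"
proof -
  let ?v = "vec n (\<lambda>j. subst (pd j p) f)"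
  have "jac n f *\<^sub>v ?v = vec n (\<lambda>k. pd k (subst p f))"
    by (rule eq_vecI) (auto simp: jac_def scalar_prod_def chain_rule[OF p] lessThan_atLeast0)
  moreover have "det (replace_col (jac n f) (jac n f *\<^sub>v ?v) i) = ?v $ i * det (jac n f)"
    by (rule cramer_lemma_mat) (use i in auto)
  ultimately show ?thesis
    using i by simp
qed

text \<open>A vanishing \<open>subst p f\<close> puts a zero column into the matrix of
  \<open>jac_cramer\<close>, and the Jacobian determinant cancels in a domain.\<close>

lemma subst_pd_eq_0:
  fixes f :: "nat \<Rightarrow> 'a::idom mpoly"
  assumes p: "in_ring n p" and i: "i < n" and J: "det (jac n f) \<noteq> 0" and z: "subst p f = 0"
  shows "subst (pd i p) f = 0"
proof -
  let ?A = "replace_col (jac n f) (vec n (\<lambda>k. pd k (subst p f))) i"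
  have A: "?A \<in> carrier_mat n n"
    by (simp add: replace_col_def jac_def)
  have "(\<Prod>j<n. ?A $$ (\<pi> j, j)) = 0" if "\<pi> permutes {0..<n}" for \<pi>
  proof (rule prod_zero)
    have "\<pi> i < n"
      using that i permutes_in_image[of \<pi> "{0..<n}" i] by auto
    then show "\<exists>j\<in>{..<n}. ?A $$ (\<pi> j, j) = 0"
      using i z by (auto simp: replace_col_def jac_def intro!: bexI[of _ i])
  qed simp
  then have "det ?A = 0"
    unfolding det_col[OF A] by (intro sum.neutral) simp
  then show ?thesis
    using jac_cramer[OF p i, of f] J by simp
qed

text \<open>Differentiating \<open>subst (g l) f = Var l\<close> exhibits a right inverse of the
  Jacobian matrix. This serves for \<open>f\<close> and, at the end, for its leading forms.\<close>

lemma det_jac_nonzero: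
  fixes f :: "nat \<Rightarrow> 'a::idom mpoly"
  assumes "\<And>l. l < n \<Longrightarrow> in_ring n (g l)" "\<And>l. l < n \<Longrightarrow> subst (g l) f = Var l"
  shows "det (jac n f) \<noteq> 0"
proof -
  let ?N = "mat n n (\<lambda>(j, l). subst (pd j (g l)) f)"
  have "jac n f * ?N = 1\<^sub>m n"
  proof (rule eq_matI)
    fix k l assume "k < dim_row (1\<^sub>m n :: 'a mpoly mat)" "l < dim_col (1\<^sub>m n :: 'a mpoly mat)"
    then have kl: "k < n" "l < n" by auto
    then have "(jac n f * ?N) $$ (k, l) = pd k (subst (g l) f)"
      by (simp add: jac_def scalar_prod_def chain_rule[OF assms(1)] lessThan_atLeast0)
    then show "(jac n f * ?N) $$ (k, l) = 1\<^sub>m n $$ (k, l)"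
      using kl assms(2) by (simp add: pd_Var)
  qed (auto simp: jac_def)
  then have "det (jac n f) * det ?N = 1"
    by (metis det_mult det_one jac_carrier mat_carrier)
  then show ?thesis
    by auto
qed

text \<open>Each Leibniz term has one factor from every column; the \<open>+ 1\<close>, the degree
  lost by differentiation, adds up to \<open>n\<close>.\<close>

lemma gdeg_det_bound:
  fixes A :: "'a::idom mpoly mat"
  assumes A: "A \<in> carrier_mat n n"
    and b: "\<And>k j. k < n \<Longrightarrow> j < n \<Longrightarrow> A $$ (k, j) = 0 \<or> gdeg w (A $$ (k, j)) + 1 \<le> b j"
  shows "det A = 0 \<or> gdeg w (det A) + n \<le> (\<Sum>j<n. b j)"
  unfolding det_col[OF A]
proof (rule gdeg_sum_bound)
  fix \<pi> assume "\<pi> \<in> {\<pi>. \<pi> permutes {0..<n}}"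
  then have "\<pi> j < n" if "j < n" for j
    using that permutes_in_image[of \<pi> "{0..<n}" j] by auto
  then have "(\<Prod>j<n. A $$ (\<pi> j, j)) = 0 \<or> gdeg w (\<Prod>j<n. A $$ (\<pi> j, j)) + (\<Sum>j<n. 1) \<le> (\<Sum>j<n. b j)"
    by (intro gdeg_prod_bound b) auto
  then show "signof \<pi> * (\<Prod>j<n. A $$ (\<pi> j, j)) = 0 \<or>
      gdeg w (signof \<pi> * (\<Prod>j<n. A $$ (\<pi> j, j))) + n \<le> (\<Sum>j<n. b j)"
    by (auto simp: sign_def)
qed

section \<open>The parachute inequality\<close>

text \<open>Compare degrees in \<open>jac_cramer\<close>: column \<open>i\<close> is bounded through
  \<open>subst p f\<close>, the others through \<open>f j\<close>, and the nonzero
  \<open>det (jac n f)\<close> only raises the degree on the other side.\<close>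

lemma parachute_step:
  fixes f :: "nat \<Rightarrow> 'a::idom mpoly"
  assumes p: "in_ring n p" and i: "i < n" and f: "\<And>j. j < n \<Longrightarrow> f j \<noteq> 0"
    and J: "det (jac n f) \<noteq> 0" and nz: "subst (pd i p) f \<noteq> 0"
  shows "subst p f \<noteq> 0 \<and> gdeg (\<lambda>_. 1) (subst (pd i p) f) + tdeg (f i) + n
           \<le> gdeg (\<lambda>_. 1) (subst p f) + (\<Sum>j<n. tdeg (f j))"
proof -
  let ?D = "gdeg (\<lambda>_. 1) :: 'a mpoly \<Rightarrow> nat"
  let ?A = "replace_col (jac n f) (vec n (\<lambda>k. pd k (subst p f))) i"
  let ?b = "\<lambda>j. if j = i then ?D (subst p f) else tdeg (f j)"
  have A: "?A \<in> carrier_mat n n"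
    by (simp add: replace_col_def jac_def)
  have entry: "?A $$ (k, j) = (if j = i then pd k (subst p f) else pd k (f j))" if "k < n" "j < n" for k j
    using that by (simp add: replace_col_def jac_def)
  have detA: "det ?A = subst (pd i p) f * det (jac n f)"
    by (rule jac_cramer[OF p i])
  then have detA_nz: "det ?A \<noteq> 0"
    using J nz by simp
  have bound: "?A $$ (k, j) = 0 \<or> ?D (?A $$ (k, j)) + 1 \<le> ?b j" if "k < n" "j < n" for k j
    using that gdeg_pd[of k "f j" "\<lambda>_. 1"] gdeg_pd[of k "subst p f" "\<lambda>_. 1"] f[of j]
    by (auto simp: entry tdeg_eq_gdeg)
  have "?D (det ?A) + n \<le> (\<Sum>j<n. ?b j)"
    using gdeg_det_bound[OF A, of "\<lambda>_. 1" ?b] bound detA_nz by blast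
  moreover have "?D (det ?A) = ?D (subst (pd i p) f) + ?D (det (jac n f))"
    using gdeg_mult[OF nz J, of "\<lambda>_. 1"] detA by metis
  moreover have "(\<Sum>j<n. ?b j) + tdeg (f i) = ?D (subst p f) + (\<Sum>j<n. tdeg (f j))"
    using i by (simp add: sum.remove[of "{..<n}" i])
  moreover have "subst p f \<noteq> 0"
    using subst_pd_eq_0[OF p i J] nz by blast
  ultimately show ?thesis
    by simp
qed

text \<open>Induction on \<open>k\<close>, one derivative per factor \<open>R\<close>: it lowers
  \<open>e\<close> by \<open>w i\<close>, and \<open>parachute_step\<close> returns this
  \<open>w i\<close> at the cost of the sum of the \<open>tdeg (f j)\<close> minus
  \<open>n\<close>.\<close>

lemma parachute:
  fixes f :: "nat \<Rightarrow> 'a::{idom,ring_char_0} mpoly"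
  defines "w \<equiv> \<lambda>i. tdeg (f i)" and "F \<equiv> \<lambda>i. top_form (f i)"
  assumes f: "\<And>j. j < n \<Longrightarrow> f j \<noteq> 0" and J: "det (jac n f) \<noteq> 0"
    and R: "in_ring n R" "subst R F = 0" and i: "i < n" "subst (pd i R) F \<noteq> 0"
    and p: "in_ring n p" "gdeg w p \<le> e"
    and q: "coeff (grade w p) e = q * R ^ k" "in_ring n q" "subst q F \<noteq> 0"
  shows "subst p f \<noteq> 0 \<and> e + k * n \<le> gdeg (\<lambda>_. 1) (subst p f) + k * (\<Sum>j<n. tdeg (f j))"
  using p q
proof (induction k arbitrary: p e q)
  case 0
  have "coeff (grade (\<lambda>_. 1) (subst p f)) e \<noteq> 0"
    using coeff_grade_subst[of n p f e] 0 f by (simp add: w_def F_def)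
  then show ?case
    by (auto intro: le_degree)
next
  case (Suc k)
  \<comment> \<open>The new cofactor of \<open>R ^ k\<close>. At \<open>F\<close> its first summand
    vanishes with \<open>R\<close>, and the second is a product of nonzero elements of a
    domain.\<close>
  let ?q = "pd i q * R + of_nat (Suc k) * q * pd i R"
  have eq: "pd i (coeff (grade w p) e) = ?q * R ^ k"
    unfolding Suc.prems(3) pd_mult pd_power_Suc by (simp add: algebra_simps)
  have q: "in_ring n ?q"
    by (intro in_ring_add in_ring_mult in_ring_pd in_ring_of_nat R Suc.prems)
  have qF: "subst ?q F \<noteq> 0"
    using R(2) i(2) Suc.prems(5) by (simp del: of_nat_Suc)
  have "R \<noteq> 0" "?q \<noteq> 0"
    using i(2) qF by (metis pd_zero subst_zero)+
  \<comment> \<open>A nonzero derivative forces \<open>w i \<le> e\<close>, so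
    \<open>e - w i\<close> is not truncated.\<close>
  then have "pd i (coeff (grade w p) e) \<noteq> 0"
    unfolding eq by (metis mult_eq_0_iff power_eq_0_iff)
  then have "gdeg w (coeff (grade w p) e) \<ge> w i"
    using gdeg_pd[of i "coeff (grade w p) e" w] by auto
  then have e: "w i \<le> e"
    unfolding grade_coeff_grade using degree_monom_le order_trans by blast
  have "coeff (grade w (pd i p)) (e - w i) = ?q * R ^ k"
    unfolding coeff_grade_pd using e eq by simp
  moreover have "gdeg w (pd i p) \<le> e - w i"
    using gdeg_pd[of i p w] Suc.prems(2) by auto
  ultimately have IH: "subst (pd i p) f \<noteq> 0"
      "e - w i + k * n \<le> gdeg (\<lambda>_. 1) (subst (pd i p) f) + k * (\<Sum>j<n. tdeg (f j))"
    using Suc.IH[OF in_ring_pd[OF Suc.prems(1)] _ _ q qF] by blast+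
  show ?case
    using parachute_step[OF Suc.prems(1) i(1) f J IH(1)] IH(2) e by (auto simp: w_def)
qed

text \<open>Each division by \<open>R\<close> lowers the \<open>w\<close>-degree strictly, so it
  stops at a quotient not vanishing at \<open>F\<close>.\<close>

lemma factor_out_relation:
  fixes R :: "'a::idom mpoly"
  assumes I: "\<And>p. in_ring n p \<Longrightarrow> subst p F = 0 \<Longrightarrow> \<exists>q. in_ring n q \<and> p = q * R"
    and R: "0 < gdeg w R" and p: "in_ring n p" "p \<noteq> 0"
  shows "\<exists>q k. in_ring n q \<and> subst q F \<noteq> 0 \<and> p = q * R ^ k"
  using p
proof (induction "gdeg w p" arbitrary: p rule: less_induct)
  case less
  show ?case
  proof (cases "subst p F = 0")
    case True
    then obtain q where q: "in_ring n q" "p = q * R"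
      using I less.prems by blast
    then have "q \<noteq> 0" "R \<noteq> 0"
      using less.prems by auto
    then have "gdeg w q < gdeg w p"
      using q R by (simp add: degree_mult_eq)
    then obtain q' k where "in_ring n q'" "subst q' F \<noteq> 0" "q = q' * R ^ k"
      using less.hyps[of q] q \<open>q \<noteq> 0\<close> by blast
    then show ?thesis
      using q by (intro exI[of _ q'] exI[of _ "Suc k"]) (simp add: algebra_simps)
  next
    case False
    then show ?thesis
      using less.prems by (intro exI[of _ p] exI[of _ 0]) simp
  qed
qed

theorem theorem2:
  fixes n :: nat and f :: "nat \<Rightarrow> 'a::field_char_0 mpoly" and R :: "'a mpoly"
  assumes "alg_closed TYPE('a)"
    and "poly_automorphism n f"
    and "in_ring n R"
    and "{P. in_ring n P \<and> subst P (\<lambda>i. top_form (f i)) = 0}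
           = {Q * R | Q. in_ring n Q}"
  shows "wdeg (\<lambda>i. tdeg (f i)) R \<le> ereal (real (\<Sum>i<n. tdeg (f i))) - ereal (real n) + 1"
proof (cases "R = 0")
  case True
  \<comment> \<open>The degree of 0 is minus infinity.\<close>
  then show ?thesis
    by (simp add: wdeg_def)
next
  case R_nz: False
  define w where "w = (\<lambda>i. tdeg (f i))"
  define F where "F = (\<lambda>i. top_form (f i))"
  obtain g where g: "\<And>l. l < n \<Longrightarrow> in_ring n (g l)"
      "\<And>l. l < n \<Longrightarrow> subst (f l) g = Var l" "\<And>l. l < n \<Longrightarrow> subst (g l) f = Var l"
    using assms(2) unfolding poly_automorphism_def by blast
  have f_in: "in_ring n (f l)" if "l < n" for l
    using assms(2) that unfolding poly_automorphism_def by blast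
  have Var_nz: "Var l \<noteq> (Poly_Mapping.single 0 c :: 'a mpoly)" for l c
    using pd_Var[of l l, where 'a='a] by (metis pd_const zero_neq_one)
  have f_nz: "f l \<noteq> 0" if "l < n" for l
    using g(2)[OF that] Var_nz[of l 0] by auto
  have J: "det (jac n f) \<noteq> 0"
    using g by (intro det_jac_nonzero) auto
  have ideal: "\<exists>q. in_ring n q \<and> p = q * R" if "in_ring n p" "subst p F = 0" for p
    using assms(4) that unfolding F_def by blast
  have "1 * R \<in> {Q * R | Q. in_ring n Q}"
    using in_ring_one by blast
  then have R0: "subst R F = 0"
    unfolding assms(4)[symmetric] F_def by simp
  \<comment> \<open>A constant \<open>f l\<close> would be fixed by substituting \<open>g\<close>
    and could not yield \<open>Var l\<close>; so some derivative is nonzero and the degree is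
    positive.\<close>
  have w_pos: "0 < w l" if l: "l < n" for l
  proof -
    have "f l \<noteq> Poly_Mapping.single 0 c" for c
      using g(2)[OF l] Var_nz[of l c] by auto
    then obtain k where k: "k < n" "pd k (f l) \<noteq> 0"
      using const_if_pd_zero[OF f_in[OF l]] by blast
    then show ?thesis
      using gdeg_pd[of k "f l" "\<lambda>_. 1"] f_nz[OF l] by (simp add: w_def tdeg_eq_gdeg)
  qed
  \<comment> \<open>If every derivative of \<open>R\<close> vanished at \<open>F\<close>, each would
    be a multiple of \<open>R\<close> of smaller weight, hence 0. Then \<open>R\<close> would be a
    nonzero constant, which cannot vanish at \<open>F\<close>.\<close>
  obtain i where i: "i < n" "subst (pd i R) F \<noteq> 0"
  proof (rule ccontr)
    assume no: "\<not> thesis"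
    note witness = that
    have "pd i R = 0" if i: "i < n" for i
    proof (rule ccontr)
      assume nz: "pd i R \<noteq> 0"
      obtain q where q: "pd i R = q * R"
        using no witness i ideal[OF in_ring_pd[OF assms(3)], of i] by blast
      then have "gdeg w (pd i R) = gdeg w q + gdeg w R"
        using nz by (auto simp: degree_mult_eq)
      then show False
        using gdeg_pd[of i R w] nz w_pos[OF i] by auto
    qed
    then have "R = Poly_Mapping.single 0 (Poly_Mapping.lookup R 0)"
      using const_if_pd_zero[OF assms(3)] by blast
    then show False
      using R0 R_nz by (metis subst_const)
  qed
  have R_deg: "0 < gdeg w R"
    using gdeg_pd[of i R w] w_pos[OF i(1)] i(2) by auto
  have "gdeg w R + n \<le> (\<Sum>j<n. w j) + 1"
  proof (rule ccontr)
    assume large: "\<not> ?thesis"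
    have "\<exists>h. in_ring n h \<and> subst h F = Var l" if l: "l < n" for l
    proof -
      define e where "e = gdeg w (g l)"
      \<comment> \<open>The preimage of \<open>Var l\<close> will be the leading form of the
        inverse's component \<open>g l\<close>.\<close>
      define h where "h = coeff (grade w (g l)) e"
      have "g l \<noteq> 0"
        using g(3)[OF l] Var_nz[of l 0] by auto
      then have h_nz: "h \<noteq> 0"
        by (simp add: h_def e_def)
      have h_in: "in_ring n h"
        unfolding h_def by (intro in_ring_coeff_grade g l)
      obtain q k where q: "in_ring n q" "subst q F \<noteq> 0" "h = q * R ^ k"
        using factor_out_relation[OF ideal R_deg h_in h_nz] by blast
      have "gdeg w h = e"
        unfolding h_def grade_coeff_grade using h_nz by (simp add: degree_monom_eq h_def)
      moreover have "gdeg w h = gdeg w q + k * gdeg w R"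
        using h_nz q(3) R_nz by (simp add: degree_mult_eq degree_power_eq grade_power)
      ultimately have "k * gdeg w R \<le> e"
        by simp
      moreover have "e + k * n \<le> gdeg (\<lambda>_. 1) (subst (g l) f) + k * (\<Sum>j<n. w j)"
        using parachute[of n f R i "g l" e q k] f_nz J assms(3) R0 i g(1)[OF l] q
        by (simp add: w_def F_def e_def h_def)
      moreover have "gdeg (\<lambda>_. 1) (subst (g l) f) = 1"
        using g(3)[OF l] Var_nz[of l 0] by (simp add: grade_Var degree_monom_eq)
      ultimately have "k * (gdeg w R + n) \<le> 1 + k * (\<Sum>j<n. w j)"
        by (simp add: algebra_simps)
      \<comment> \<open>By \<open>large\<close>, the left factor is at least the sum plus 2; with
        the previous bound this gives \<open>2 * k \<le> 1\<close>.\<close>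
      moreover have "k * ((\<Sum>j<n. w j) + 2) \<le> k * (gdeg w R + n)"
        using large by (intro mult_le_mono) auto
      ultimately have "k = 0"
        by (simp add: algebra_simps)
      then have "subst h F \<noteq> 0"
        using q by simp
      \<comment> \<open>A nonzero component of the single term \<open>Var l\<close> is
        \<open>Var l\<close> itself.\<close>
      moreover have "subst h F = coeff (grade (\<lambda>_. 1) (Var l)) e"
        using coeff_grade_subst[of n "g l" f e] g(1,3)[OF l] f_nz by (simp add: e_def h_def w_def F_def)
      ultimately show ?thesis
        using h_in by (auto simp: grade_Var split: if_splits)
    qed
    then obtain h where h: "\<And>l. l < n \<Longrightarrow> in_ring n (h l)" "\<And>l. l < n \<Longrightarrow> subst (h l) F = Var l"
      by metis
    have JF: "det (jac n F) \<noteq> 0"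
      using h by (rule det_jac_nonzero)
    show False
      using subst_pd_eq_0[OF assms(3) i(1) JF R0] i(2) by blast
  qed
  then have "real (gdeg w R) \<le> real (\<Sum>j<n. w j) - real n + 1"
    by linarith
  then show ?thesis
    using R_nz by (simp add: wdeg_eq_gdeg w_def one_ereal_def)
qed

end
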